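(* Let $S=\{123,231\}$. For $n\ge1$ and $0\le c<n$, $$f_S(n,c,x)=f_S(n-1,c+1,x)+\sum_{i=2}^{n}x^{\min\{c,\,i-1,\,n-c,\,n-i+1\}}.$$ Also, for $c\ge0$, $f_S(0,c,x)=f_S(1,c,x)=1$, and $f_S(n,c,x)=\binom n2+1$ for $n\le c$; and $f_S(n,c,1)=\binom n2+1$. Moreover, writing $f_S(n,x)=f_S(n,0,x)$, for $n\ge0$, $$\begin{aligned}f_S(n+8,x)={}&f_S(n+7,x)+2f_S(n+6,x)+(x-2)f_S(n+5,x)\\&-(x+1)f_S(n+4,x)-(2x-1)f_S(n+3,x)\\&+2x\,f_S(n+2,x)+x\,f_S(n+1,x)-x\,f_S(n,x),\end{aligned}$$ where $f_S(0,x)=1$, $f_S(1,x)=1$, $f_S(2,x)=2$, $f_S(3,x)=x+3$, $f_S(4,x)=2x+5$, $f_S(5,x)=5x+6$, $f_S(6,x)=x^2+6x+9$, $f_S(7,x)=2x^2+10x+10$ and $f_S(8,x)=5x^2+10x+14$.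
   Context: $\mathfrak S_n$ is the set of permutations of $\{1,\dots,n\}$. $\operatorname{Av}_n(S)$ is the set of $\pi\in\mathfrak S_n$ having no subsequence order-isomorphic to any element of $S$. For $\pi\in\mathfrak S_n$ and $c\in\mathbb Z$, the number of shifted double deficiencies of $\pi$ with shift $c$ is $$\operatorname{DD}_c(\pi)=\#\{j\in\{1,\ldots,n\}: 1\le j+c\le n,\ \pi(j)<j+c<\pi^{-1}(j+c)+c\}.$$ For $c=0$ this is the number $\operatorname{DD}(\pi)$ of double deficiencies, i.e. of indices $k$ with $\pi(k)<k<\pi^{-1}(k)$. For $n,c\ge0$, $f_S(n,c,x)=\sum_{\pi\in\operatorname{Av}_n(S)}x^{\operatorname{DD}_c(\pi)}$. *)

theory Defs
  imports
    "HOL-Library.Sublist"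
    "HOL-Combinatorics.Permutations"
    "HOL-Computational_Algebra.Polynomial"
begin

(* Patterns are written in one-line notation as lists, so 231 is [2, 3, 1]. *)

definition order_isomorphic :: "nat list \<Rightarrow> nat list \<Rightarrow> bool" where
  "order_isomorphic us vs \<longleftrightarrow> length us = length vs \<and>
     (\<forall>i < length us. \<forall>j < length us. us ! i < us ! j \<longleftrightarrow> vs ! i < vs ! j)"

definition contains_pattern :: "nat \<Rightarrow> (nat \<Rightarrow> nat) \<Rightarrow> nat list \<Rightarrow> bool" where
  "contains_pattern n \<pi> \<sigma> \<longleftrightarrow>
     (\<exists>us. subseq us (map \<pi> [1..<n + 1]) \<and> order_isomorphic us \<sigma>)"

definition Av :: "nat \<Rightarrow> nat list set \<Rightarrow> (nat \<Rightarrow> nat) set" where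
  "Av n S = {\<pi>. \<pi> permutes {1..n} \<and> (\<forall>\<sigma>\<in>S. \<not> contains_pattern n \<pi> \<sigma>)}"

(* The conversion nat is only relevant where 1 \<le> j + c holds. *)
definition DD :: "nat \<Rightarrow> int \<Rightarrow> (nat \<Rightarrow> nat) \<Rightarrow> nat" where
  "DD n c \<pi> = card {j \<in> {1..n}.
     1 \<le> int j + c \<and> int j + c \<le> int n \<and>
     int (\<pi> j) < int j + c \<and> int j + c < int (inv \<pi> (nat (int j + c))) + c}"

abbreviation poly_X :: "int poly" where
  "poly_X \<equiv> [:0, 1:]"

definition f_poly :: "nat list set \<Rightarrow> nat \<Rightarrow> nat \<Rightarrow> int poly" where
  "f_poly S n c = (\<Sum>\<pi>\<in>Av n S. poly_X ^ DD n (int c) \<pi>)"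

end

theory Submission
  imports Defs
begin

text \<open>
  Let \<open>n\<close> occur in a permutation avoiding 123 and 231 as \<open>L n R\<close>. Avoiding 231 puts every
  entry of \<open>L\<close> below every entry of \<open>R\<close>, and avoiding 123 makes \<open>L\<close> decreasing; if \<open>L\<close> is
  nonempty then \<open>R\<close> is decreasing as well. So an avoider either starts with \<open>n\<close>, followed by
  an arbitrary avoider of length \<open>n - 1\<close>, or it is one of the \<open>n - 1\<close> permutations
  \<open>k ... 1 n ... k+1\<close> (lemma \<open>avoiders_Suc\<close>).

  Deleting a leading \<open>n\<close> moves positions by one and leaves values unchanged, so it raises the shift
  by one (\<open>DD_prepend_max\<close>). A two-block permutation is an involution, which turns both defining
  inequalities of its deficiencies into one chain whose solutions form an interval
  (\<open>DD_two_block\<close>). This gives the recursion for \<open>f n c\<close>, the values at 1, and the values for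
  large shifts.

  For the recurrence at shift 0, note that replacing \<open>(n, c, k)\<close> by \<open>(n + 2, c + 1, k + 1)\<close>
  adds one to each of \<open>c\<close>, \<open>k\<close>, \<open>n - c\<close>, \<open>n - k\<close>, hence to their minimum. Therefore
  \<open>f (n + 2) (c + 1) - x f n c\<close> changes only by the constant \<open>2 x\<close> along antidiagonals of
  \<open>(n, c)\<close>, and can be followed down to the range where the shift is too large to matter.
  The outcome is \<open>f (n + 3) 0 = x f n 0 + q n\<close> with \<open>q\<close> an explicit quadratic quasipolynomial of
  period 2 (\<open>f_even\<close>, \<open>f_odd\<close>). In terms of the backward shift \<open>t\<close>, the operator
  \<open>(1 - t) (1 - t^2)^2\<close> annihilates \<open>q\<close>, and the recurrence of order 8 is the product
  \<open>(1 - x t^3) (1 - t) (1 - t^2)^2\<close> applied to \<open>f n 0\<close>.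
\<close>

section \<open>Pattern avoidance in terms of positions\<close>

lemma contains_pattern3_iff:
  "contains_pattern n \<pi> [a, b, c] \<longleftrightarrow>
     (\<exists>i j k. 1 \<le> i \<and> i < j \<and> j < k \<and> k \<le> n \<and> order_isomorphic [\<pi> i, \<pi> j, \<pi> k] [a, b, c])"
    (is "?L \<longleftrightarrow> ?R")
proof
  assume ?L
  then obtain us where us: "subseq us (map \<pi> [1..<n + 1])" "order_isomorphic us [a, b, c]"
    by (auto simp: contains_pattern_def)
  then obtain N where "us = nths (map \<pi> [1..<n + 1]) N"
    by (auto simp: subseq_conv_nths)
  then have us_eq: "us = map \<pi> (nths [1..<n + 1] N)"
    by (simp only: nths_map)
  define l where "l = nths [1..<n + 1] N"
  have "length l = Suc (Suc (Suc 0))"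
    using us us_eq by (simp add: order_isomorphic_def l_def)
  then obtain i j k where l: "l = [i, j, k]"
    by (auto simp: length_Suc_conv)
  have "sorted l" "distinct l"
    unfolding l_def by (simp_all add: sorted_nths distinct_nthsI del: upt_Suc)
  moreover have "set l \<subseteq> {1..n}"
    using set_nths_subset[of "[1..<n + 1]" N] unfolding l_def by auto
  ultimately have "1 \<le> i" "i < j" "j < k" "k \<le> n"
    by (auto simp: l)
  with us us_eq show ?R
    unfolding l_def[symmetric] l by auto
next
  assume ?R
  then obtain i j k where ijk: "1 \<le> i" "i < j" "j < k" "k \<le> n"
    and iso: "order_isomorphic [\<pi> i, \<pi> j, \<pi> k] [a, b, c]"
    by blast
  have "filter (\<lambda>x. x \<in> {i, j, k}) [1..<n + 1] = [i, j, k]"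
    by (rule sorted_distinct_set_unique) (use ijk in \<open>auto simp: sorted_wrt_filter simp del: upt_Suc\<close>)
  then have "subseq [i, j, k] [1..<n + 1]"
    by (metis subseq_filter_left)
  then have "subseq (map \<pi> [i, j, k]) (map \<pi> [1..<n + 1])"
    by (rule subseq_map)
  with iso show ?L
    unfolding contains_pattern_def by auto
qed

lemma all_less_3: "(\<forall>i < Suc (Suc (Suc 0)). P i) \<longleftrightarrow> P 0 \<and> P 1 \<and> P 2"
  by (auto simp: less_Suc_eq numeral_2_eq_2)

definition avoiders :: "nat \<Rightarrow> (nat \<Rightarrow> nat) set" where
  "avoiders n = Av n {[1, 2, 3], [2, 3, 1]}"

lemma avoiders_iff:
  "\<pi> \<in> avoiders n \<longleftrightarrow> \<pi> permutes {1..n} \<and>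
     (\<forall>i j k. 1 \<le> i \<and> i < j \<and> j < k \<and> k \<le> n \<longrightarrow>
        \<not> (\<pi> i < \<pi> j \<and> \<pi> j < \<pi> k) \<and> \<not> (\<pi> k < \<pi> i \<and> \<pi> i < \<pi> j))"
proof -
  have "order_isomorphic [x, y, z] [1, 2, 3] \<longleftrightarrow> x < y \<and> y < z" for x y z
    by (auto simp: order_isomorphic_def all_less_3)
  moreover have "order_isomorphic [x, y, z] [2, 3, 1] \<longleftrightarrow> z < x \<and> x < y" for x y z
    by (auto simp: order_isomorphic_def all_less_3)
  ultimately show ?thesis
    unfolding avoiders_def Av_def by (auto simp: contains_pattern3_iff)
qed

lemma finite_avoiders: "finite (avoiders n)"
  by (rule finite_subset[OF _ finite_permutations[of "{1..n}"]]) (auto simp: avoiders_iff)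

text \<open>
  A permutation is determined by its comparisons; this recovers the values of an avoider once
  its relative order is known.
\<close>
lemma permutes_card_le:
  assumes "\<pi> permutes {1..n}" "i \<in> {1..n}"
  shows "card {u \<in> {1..n}. \<pi> u \<le> \<pi> i} = (\<pi> i :: nat)"
proof -
  have inj: "inj_on \<pi> {u \<in> {1..n}. \<pi> u \<le> \<pi> i}"
    using permutes_inj[OF assms(1)] by (rule inj_on_subset) simp
  have i: "\<pi> i \<in> {1..n}"
    using permutes_in_image[OF assms(1)] assms(2) by blast
  have "\<pi> ` {u \<in> {1..n}. \<pi> u \<le> \<pi> i} = {1..\<pi> i}"
  proof (intro equalityI subsetI)
    fix v assume "v \<in> \<pi> ` {u \<in> {1..n}. \<pi> u \<le> \<pi> i}"
    then show "v \<in> {1..\<pi> i}"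
      using permutes_in_image[OF assms(1)] by auto
  next
    fix v assume v: "v \<in> {1..\<pi> i}"
    with i have "v \<in> {1..n}" by auto
    then obtain u where "u \<in> {1..n}" "v = \<pi> u"
      using permutes_image[OF assms(1)] by blast
    with v show "v \<in> \<pi> ` {u \<in> {1..n}. \<pi> u \<le> \<pi> i}" by auto
  qed
  with card_image[OF inj] show ?thesis by simp
qed

section \<open>The two kinds of avoiders\<close>

text \<open>
  In one-line notation on \<open>{1..n}\<close>, the first map writes \<open>m + 1\<close> in front of \<open>\<sigma>\<close>, and the second is
  \<open>k ... 1 n ... k+1\<close>. Both are the identity elsewhere, as permutations of \<open>{1..n}\<close> have to be.
\<close>
definition prepend_max :: "nat \<Rightarrow> (nat \<Rightarrow> nat) \<Rightarrow> nat \<Rightarrow> nat" where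
  "prepend_max m \<sigma> i =
     (if i = 1 then Suc m else if 2 \<le> i \<and> i \<le> Suc m then \<sigma> (i - 1) else i)"

definition two_block :: "nat \<Rightarrow> nat \<Rightarrow> nat \<Rightarrow> nat" where
  "two_block n k i =
     (if 1 \<le> i \<and> i \<le> k then k + 1 - i else if k < i \<and> i \<le> n then n + k + 1 - i else i)"

lemma prepend_max_permutes:
  assumes "\<sigma> permutes {1..m}"
  shows "prepend_max m \<sigma> permutes {1..Suc m}"
proof (rule bij_imp_permutes)
  have im: "\<sigma> i \<in> {1..m} \<longleftrightarrow> i \<in> {1..m}" for i
    using permutes_in_image[OF assms] .
  have inj: "\<sigma> i = \<sigma> j \<longleftrightarrow> i = j" for i j
    using permutes_inj[OF assms] by (auto dest: injD)
  have "inj_on (prepend_max m \<sigma>) {1..Suc m}"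
  proof (rule inj_onI)
    fix i j assume *: "i \<in> {1..Suc m}" "j \<in> {1..Suc m}" "prepend_max m \<sigma> i = prepend_max m \<sigma> j"
    show "i = j"
      using * im[of "i - 1"] im[of "j - 1"] inj[of "i - 1" "j - 1"]
      by (auto simp: prepend_max_def split: if_splits)
  qed
  moreover have "prepend_max m \<sigma> ` {1..Suc m} \<subseteq> {1..Suc m}"
  proof
    fix v assume "v \<in> prepend_max m \<sigma> ` {1..Suc m}"
    then obtain i where i: "i \<in> {1..Suc m}" "v = prepend_max m \<sigma> i" by blast
    then show "v \<in> {1..Suc m}"
      using im[of "i - 1"] by (auto simp: prepend_max_def split: if_splits)
  qed
  ultimately show "bij_betw (prepend_max m \<sigma>) {1..Suc m} {1..Suc m}"
    by (simp only: bij_betw_def endo_inj_surj[OF finite_atLeastAtMost] simp_thms)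
qed (auto simp: prepend_max_def)

lemma two_block_permutes:
  assumes "k \<le> n"
  shows "two_block n k permutes {1..n}"
proof (rule bij_imp_permutes)
  show "bij_betw (two_block n k) {1..n} {1..n}"
    by (rule bij_betw_byWitness[where f' = "two_block n k"])
      (use assms in \<open>auto simp: two_block_def\<close>)
qed (use assms in \<open>auto simp: two_block_def\<close>)

lemma prepend_max_in_avoiders:
  assumes "\<sigma> \<in> avoiders m"
  shows "prepend_max m \<sigma> \<in> avoiders (Suc m)"
  unfolding avoiders_iff
proof (intro conjI allI impI)
  have perm: "\<sigma> permutes {1..m}" using assms by (simp add: avoiders_iff)
  then show perm': "prepend_max m \<sigma> permutes {1..Suc m}" by (rule prepend_max_permutes)
  fix i j k :: nat
  assume ijk: "1 \<le> i \<and> i < j \<and> j < k \<and> k \<le> Suc m"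
  have "prepend_max m \<sigma> j \<in> {1..Suc m}"
    using permutes_in_image[OF perm', of j] ijk by auto
  then have top: "prepend_max m \<sigma> j \<le> Suc m" by simp
  have avoid: "\<not> (\<sigma> (i - 1) < \<sigma> (j - 1) \<and> \<sigma> (j - 1) < \<sigma> (k - 1)) \<and>
     \<not> (\<sigma> (k - 1) < \<sigma> (i - 1) \<and> \<sigma> (i - 1) < \<sigma> (j - 1))" if "i \<noteq> 1"
  proof -
    have "1 \<le> i - 1 \<and> i - 1 < j - 1 \<and> j - 1 < k - 1 \<and> k - 1 \<le> m"
      using ijk that by auto
    then show ?thesis using assms unfolding avoiders_iff by blast
  qed
  show "\<not> (prepend_max m \<sigma> i < prepend_max m \<sigma> j \<and> prepend_max m \<sigma> j < prepend_max m \<sigma> k)"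
    using top avoid ijk by (cases "i = 1") (auto simp: prepend_max_def)
  show "\<not> (prepend_max m \<sigma> k < prepend_max m \<sigma> i \<and> prepend_max m \<sigma> i < prepend_max m \<sigma> j)"
    using top avoid ijk by (cases "i = 1") (auto simp: prepend_max_def)
qed

lemma two_block_in_avoiders:
  assumes "k \<le> n"
  shows "two_block n k \<in> avoiders n"
  unfolding avoiders_iff using two_block_permutes[OF assms] assms
  by (auto simp: two_block_def split: if_splits)

lemma avoiders_max_first:
  assumes "\<pi> \<in> avoiders (Suc m)" "\<pi> 1 = Suc m"
  shows "\<pi> \<in> prepend_max m ` avoiders m"
proof -
  have perm: "\<pi> permutes {1..Suc m}" using assms by (simp add: avoiders_iff)
  have im: "\<pi> i \<in> {1..Suc m} \<longleftrightarrow> i \<in> {1..Suc m}" for i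
    using permutes_in_image[OF perm] .
  have inj: "\<pi> i = \<pi> j \<longleftrightarrow> i = j" for i j
    using permutes_inj[OF perm] by (auto dest: injD)
  define \<sigma> where "\<sigma> i = (if i \<in> {1..m} then \<pi> (Suc i) else i)" for i
  have "\<sigma> permutes {1..m}"
  proof (rule bij_imp_permutes)
    have "\<sigma> ` {1..m} \<subseteq> {1..m}"
    proof
      fix v assume "v \<in> \<sigma> ` {1..m}"
      then obtain i where "i \<in> {1..m}" "v = \<pi> (Suc i)" by (auto simp: \<sigma>_def)
      then show "v \<in> {1..m}"
        using im[of "Suc i"] inj[of "Suc i" 1] assms(2) by auto
    qed
    moreover have "inj_on \<sigma> {1..m}"
      by (auto simp: inj_on_def \<sigma>_def inj)
    ultimately show "bij_betw \<sigma> {1..m} {1..m}"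
      by (simp only: bij_betw_def endo_inj_surj[OF finite_atLeastAtMost] simp_thms)
  qed (auto simp: \<sigma>_def)
  moreover have "\<not> (\<sigma> i < \<sigma> j \<and> \<sigma> j < \<sigma> k) \<and> \<not> (\<sigma> k < \<sigma> i \<and> \<sigma> i < \<sigma> j)"
    if "1 \<le> i \<and> i < j \<and> j < k \<and> k \<le> m" for i j k
  proof -
    have "1 \<le> Suc i \<and> Suc i < Suc j \<and> Suc j < Suc k \<and> Suc k \<le> Suc m" using that by auto
    then have "\<not> (\<pi> (Suc i) < \<pi> (Suc j) \<and> \<pi> (Suc j) < \<pi> (Suc k)) \<and>
        \<not> (\<pi> (Suc k) < \<pi> (Suc i) \<and> \<pi> (Suc i) < \<pi> (Suc j))"
      using assms(1) unfolding avoiders_iff by blast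
    then show ?thesis using that by (simp add: \<sigma>_def)
  qed
  ultimately have "\<sigma> \<in> avoiders m" unfolding avoiders_iff by blast
  moreover have "\<pi> = prepend_max m \<sigma>"
  proof
    fix i show "\<pi> i = prepend_max m \<sigma> i"
      using assms(2) permutes_not_in[OF perm, of i]
      by (cases "i = 0") (auto simp: prepend_max_def \<sigma>_def)
  qed
  ultimately show ?thesis by blast
qed

text \<open>
  The entry before the maximum rules out every ascent to the right of it (by 123), and the maximum
  itself rules out ascents to its left (by 123) and descents across it (by 231). This fixes
  the relative order of all entries.
\<close>
lemma avoiders_max_not_first:
  assumes "\<pi> \<in> avoiders n" "\<pi> (Suc k) = n" "1 \<le> k" "k < n"
  shows "\<pi> = two_block n k"
proof
  have perm: "\<pi> permutes {1..n}" using assms by (simp add: avoiders_iff)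
  have im: "i \<in> {1..n} \<Longrightarrow> \<pi> i \<in> {1..n}" for i
    using permutes_in_image[OF perm] by blast
  have inj: "\<pi> i = \<pi> j \<longleftrightarrow> i = j" for i j
    using permutes_inj[OF perm] by (auto dest: injD)
  have avoid: "\<not> (\<pi> i < \<pi> j \<and> \<pi> j < \<pi> l) \<and> \<not> (\<pi> l < \<pi> i \<and> \<pi> i < \<pi> j)"
    if "1 \<le> i" "i < j" "j < l" "l \<le> n" for i j l
    using assms(1) that unfolding avoiders_iff by blast
  have max: "\<pi> i < n" if "i \<in> {1..n}" "i \<noteq> Suc k" for i
    using im[OF that(1)] inj[of i "Suc k"] that assms(2) by auto
  have across: "\<pi> i < \<pi> j" if "1 \<le> i" "i \<le> k" "k < j" "j \<le> n" for i j
  proof (cases "j = Suc k")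
    case True
    then show ?thesis using max[of i] that assms by auto
  next
    case False
    then show ?thesis
      using avoid[of i "Suc k" j] max[of i] inj[of i j] that assms(2) by force
  qed
  have left: "\<pi> j < \<pi> i" if "1 \<le> i" "i < j" "j \<le> k" for i j
    using avoid[of i j "Suc k"] max[of j] inj[of i j] that assms by force
  have right: "\<pi> j < \<pi> i" if "k < i" "i < j" "j \<le> n" for i j
    using avoid[of 1 i j] across[of 1 i] inj[of i j] that assms(3) by force
  fix i
  consider "i \<notin> {1..n}" | "1 \<le> i" "i \<le> k" | "k < i" "i \<le> n" by force
  then show "\<pi> i = two_block n k i"
  proof cases
    case 1
    then show ?thesis
      using permutes_not_in[OF perm 1] assms by (auto simp: two_block_def)
  next
    case 2
    have "\<pi> u \<le> \<pi> i \<longleftrightarrow> i \<le> u \<and> u \<le> k" if "u \<in> {1..n}" for u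
      using left[of u i] left[of i u] across[of i u] 2 that by (cases i u rule: linorder_cases) force+
    then have "{u \<in> {1..n}. \<pi> u \<le> \<pi> i} = {i..k}"
      using 2 assms(4) by auto
    then show ?thesis
      using permutes_card_le[OF perm, of i] 2 assms(4) by (simp add: two_block_def)
  next
    case 3
    have "\<pi> u \<le> \<pi> i \<longleftrightarrow> u \<le> k \<or> i \<le> u" if "u \<in> {1..n}" for u
      using right[of u i] right[of i u] across[of u i] 3 that by (cases i u rule: linorder_cases) force+
    then have "{u \<in> {1..n}. \<pi> u \<le> \<pi> i} = {1..k} \<union> {i..n}"
      using 3 assms(4) by auto
    moreover have "card ({1..k} \<union> {i..n}) = k + (n + 1 - i)"
      using 3 by (subst card_Un_disjoint) auto
    ultimately show ?thesis
      using permutes_card_le[OF perm, of i] 3 assms(3) by (simp add: two_block_def)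
  qed
qed

lemma avoiders_Suc: "avoiders (Suc m) = prepend_max m ` avoiders m \<union> two_block (Suc m) ` {1..m}"
proof (intro equalityI subsetI)
  fix \<pi> assume \<pi>: "\<pi> \<in> avoiders (Suc m)"
  then have perm: "\<pi> permutes {1..Suc m}" by (simp add: avoiders_iff)
  have "Suc m \<in> \<pi> ` {1..Suc m}" using permutes_image[OF perm] by auto
  then obtain p where p: "p \<in> {1..Suc m}" "\<pi> p = Suc m" by force
  show "\<pi> \<in> prepend_max m ` avoiders m \<union> two_block (Suc m) ` {1..m}"
  proof (cases "p = 1")
    case True
    then show ?thesis using avoiders_max_first[OF \<pi>] p by simp
  next
    case False
    then have "\<pi> = two_block (Suc m) (p - 1)"
      using p by (intro avoiders_max_not_first[OF \<pi>]) auto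
    moreover have "p - 1 \<in> {1..m}" using p False by auto
    ultimately show ?thesis by blast
  qed
next
  fix \<pi> assume "\<pi> \<in> prepend_max m ` avoiders m \<union> two_block (Suc m) ` {1..m}"
  then show "\<pi> \<in> avoiders (Suc m)"
    using prepend_max_in_avoiders two_block_in_avoiders by fastforce
qed

lemma inj_on_prepend_max: "inj_on (prepend_max m) (avoiders m)"
proof (rule inj_onI, rule ext)
  fix \<sigma> \<tau> i
  assume *: "\<sigma> \<in> avoiders m" "\<tau> \<in> avoiders m" "prepend_max m \<sigma> = prepend_max m \<tau>"
  have perm: "\<sigma> permutes {1..m}" "\<tau> permutes {1..m}" using * by (simp_all add: avoiders_iff)
  show "\<sigma> i = \<tau> i"
  proof (cases "i \<in> {1..m}")
    case True
    then show ?thesis using fun_cong[OF *(3), of "Suc i"] by (simp add: prepend_max_def)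
  next
    case False
    then show ?thesis using perm by (simp add: permutes_not_in)
  qed
qed

lemma inj_on_two_block: "inj_on (two_block n) {1..<n}"
proof (rule inj_onI)
  fix k l assume *: "k \<in> {1..<n}" "l \<in> {1..<n}" "two_block n k = two_block n l"
  have "two_block n k 1 = two_block n l 1" by (simp only: *(3))
  with *(1,2) show "k = l" by (simp add: two_block_def)
qed

lemma sum_avoiders_Suc:
  fixes g :: "(nat \<Rightarrow> nat) \<Rightarrow> 'a :: comm_monoid_add"
  shows "sum g (avoiders (Suc m)) =
    (\<Sum>\<sigma>\<in>avoiders m. g (prepend_max m \<sigma>)) + (\<Sum>k = 1..m. g (two_block (Suc m) k))"
proof -
  have "prepend_max m \<sigma> \<noteq> two_block (Suc m) k" if "k \<in> {1..m}" for \<sigma> k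
  proof
    assume "prepend_max m \<sigma> = two_block (Suc m) k"
    from fun_cong[OF this, of 1] that show False
      by (simp add: prepend_max_def two_block_def)
  qed
  then have "prepend_max m ` avoiders m \<inter> two_block (Suc m) ` {1..m} = {}" by fast
  moreover have "inj_on (two_block (Suc m)) {1..m}"
    using inj_on_two_block[of "Suc m"] by (simp add: atLeastLessThanSuc_atLeastAtMost)
  ultimately show ?thesis
    by (simp add: avoiders_Suc sum.union_disjoint finite_avoiders sum.reindex inj_on_prepend_max)
qed

lemma avoiders_0: "avoiders 0 = {id}"
  by (auto simp: avoiders_iff)

lemma card_avoiders: "card (avoiders n) = (n choose 2) + 1"
proof (induction n)
  case 0
  show ?case by (simp add: avoiders_0)
next
  case (Suc n)
  then show ?case
    using sum_avoiders_Suc[of "\<lambda>_. 1 :: nat" n] by (simp add: numeral_2_eq_2)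
qed

section \<open>Shifted double deficiencies of the avoiders\<close>

text \<open>
  Replacing the inverse by a later position \<open>u\<close> that carries the value \<open>j + c\<close> cancels the shift in
  the second inequality.
\<close>
lemma DD_eq:
  assumes "\<pi> permutes {1..n}"
  shows "DD n (int c) \<pi> = card {j \<in> {1..n}. j + c \<le> n \<and> \<pi> j < j + c \<and>
    (\<exists>u \<in> {1..n}. \<pi> u = j + c \<and> j < u)}"
proof -
  have iff: "(int (\<pi> j) < int j + int c \<and> int j + int c < int (inv \<pi> (nat (int j + int c))) + int c)
     \<longleftrightarrow> \<pi> j < j + c \<and> (\<exists>u \<in> {1..n}. \<pi> u = j + c \<and> j < u)"
    if "j \<in> {1..n}" "j + c \<le> n" for j
  proof -
    have "nat (int j + int c) = j + c" by simp
    moreover have "\<pi> u = j + c \<longleftrightarrow> inv \<pi> (j + c) = u" for u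
      using permutes_inv_eq[OF assms] by metis
    moreover have "inv \<pi> (j + c) \<in> {1..n}"
      using permutes_in_image[OF permutes_inv[OF assms]] that by auto
    ultimately show ?thesis by auto
  qed
  show ?thesis
    unfolding DD_def
  proof (intro arg_cong[where f = card] Collect_cong conj_cong[OF refl])
    fix j assume "j \<in> {1..n}"
    then show "(1 \<le> int j + int c \<and> int j + int c \<le> int n \<and> int (\<pi> j) < int j + int c \<and>
        int j + int c < int (inv \<pi> (nat (int j + int c))) + int c) \<longleftrightarrow>
      (j + c \<le> n \<and> \<pi> j < j + c \<and> (\<exists>u \<in> {1..n}. \<pi> u = j + c \<and> j < u))"
      using iff[of j] by (cases "j + c \<le> n") force+
  qed
qed

text \<open>
  Position \<open>i\<close> of \<open>\<sigma>\<close> becomes position \<open>i + 1\<close> while values stay, so comparing with the value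
  \<open>i + 1 + c\<close> is a comparison with shift \<open>c + 1\<close>. Neither the new first position nor the value
  \<open>m + 1\<close> contributes: the former holds the maximum, and the latter occurs too early.
\<close>
lemma DD_prepend_max:
  assumes "\<sigma> permutes {1..m}"
  shows "DD (Suc m) (int c) (prepend_max m \<sigma>) = DD m (int (Suc c)) \<sigma>"
proof -
  let ?\<pi> = "prepend_max m \<sigma>"
  let ?A = "{i \<in> {1..m}. i + Suc c \<le> m \<and> \<sigma> i < i + Suc c \<and>
    (\<exists>u \<in> {1..m}. \<sigma> u = i + Suc c \<and> i < u)}"
  let ?B = "{j \<in> {1..Suc m}. j + c \<le> Suc m \<and> ?\<pi> j < j + c \<and>
    (\<exists>u \<in> {1..Suc m}. ?\<pi> u = j + c \<and> j < u)}"
  have im: "i \<in> {1..m} \<Longrightarrow> \<sigma> i \<in> {1..m}" for i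
    using permutes_in_image[OF assms] by blast
  have \<pi>_Suc: "?\<pi> (Suc i) = \<sigma> i" if "i \<in> {1..m}" for i
    using that by (simp add: prepend_max_def)
  have "?B = Suc ` ?A"
  proof (intro equalityI subsetI)
    fix j assume j: "j \<in> ?B"
    then obtain u where u: "u \<in> {1..Suc m}" "?\<pi> u = j + c" "j < u" by blast
    have "j \<noteq> 1" using j by (auto simp: prepend_max_def)
    then obtain i where i: "j = Suc i" "i \<in> {1..m}" using j by (cases j) auto
    obtain u' where u': "u = Suc u'" "u' \<in> {1..m}" using u i by (cases u) auto
    have "\<sigma> u' = i + Suc c" "i < u'" "\<sigma> i < i + Suc c"
      using u u' i j \<pi>_Suc by auto
    moreover have "i + Suc c \<le> m" using im[OF u'(2)] calculation(1) by simp
    ultimately have "i \<in> ?A" using i u' by blast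
    then show "j \<in> Suc ` ?A" using i by blast
  next
    fix j assume "j \<in> Suc ` ?A"
    then obtain i u where "j = Suc i" "i \<in> {1..m}" "i + Suc c \<le> m" "\<sigma> i < i + Suc c"
      "u \<in> {1..m}" "\<sigma> u = i + Suc c" "i < u" by blast
    then show "j \<in> ?B"
      using \<pi>_Suc[of i] \<pi>_Suc[of u] by (auto intro!: bexI[of _ "Suc u"])
  qed
  then have "card ?B = card ?A" by (simp add: card_image)
  then show ?thesis
    by (simp only: DD_eq[OF prepend_max_permutes[OF assms]] DD_eq[OF assms])
qed

text \<open>
  Since the permutation is its own inverse, \<open>j\<close> counts iff its image is below \<open>j + c\<close> and the image
  of \<open>j + c\<close> is above \<open>j\<close>. If \<open>j\<close> and \<open>j + c\<close> lie in the same block, these bound \<open>2 j + c\<close> strictly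
  from both sides by the same number; if they lie in different blocks, both conditions hold.
  So one counts the \<open>j \<le> k\<close> with \<open>k < j + c \<le> n\<close>.
\<close>
lemma DD_two_block:
  assumes "1 \<le> k" "k < n" "c \<le> n"
  shows "DD n (int c) (two_block n k) = min (min c k) (min (n - c) (n - k))"
proof -
  have ex_iff: "(\<exists>u \<in> {1..n}. two_block n k u = v \<and> j < u) \<longleftrightarrow> j < two_block n k v"
    if "v \<in> {1..n}" for j v
  proof -
    have "two_block n k (two_block n k u) = u" for u
      using assms by (auto simp: two_block_def)
    moreover have "two_block n k v \<in> {1..n}"
      using permutes_in_image[OF two_block_permutes, of k n v] that assms by simp
    ultimately show ?thesis by metis
  qed
  have "{j \<in> {1..n}. j + c \<le> n \<and> two_block n k j < j + c \<and>
      (\<exists>u \<in> {1..n}. two_block n k u = j + c \<and> j < u)} =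
    {j \<in> {1..n}. j + c \<le> n \<and> two_block n k j < j + c \<and> j < two_block n k (j + c)}"
    by (intro Collect_cong conj_cong refl ex_iff) auto
  also have "\<dots> = {max 1 (k + 1 - c)..min k (n - c)}"
    using assms by (auto simp: two_block_def split: if_splits)
  finally have "DD n (int c) (two_block n k) = card {max 1 (k + 1 - c)..min k (n - c)}"
    using assms by (simp only: DD_eq[OF two_block_permutes] less_imp_le)
  moreover have "Suc (min k (n - c)) - max 1 (k + 1 - c) = min (min c k) (min (n - c) (n - k))"
    using assms by (cases "k \<le> c"; cases "k \<le> n - c"; cases "c \<le> n - k") (auto simp: min_def max_def)
  ultimately show ?thesis by (simp only: card_atLeastAtMost)
qed

lemma DD_large_shift: "n \<le> c \<Longrightarrow> DD n (int c) \<pi> = 0"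
  by (auto simp: DD_def)

section \<open>The recursion in the length and the shift\<close>

definition f :: "nat \<Rightarrow> nat \<Rightarrow> int poly" where
  "f n c = (\<Sum>\<pi>\<in>avoiders n. poly_X ^ DD n (int c) \<pi>)"

text \<open>The contribution of the two-block permutations of length \<open>n\<close>.\<close>
definition block_sum :: "nat \<Rightarrow> nat \<Rightarrow> int poly" where
  "block_sum n c = (\<Sum>k = 1..<n. poly_X ^ min (min c k) (min (n - c) (n - k)))"

lemma f_Suc:
  assumes "c \<le> m"
  shows "f (Suc m) c = f m (Suc c) + block_sum (Suc m) c"
proof -
  have "f (Suc m) c = (\<Sum>\<sigma>\<in>avoiders m. poly_X ^ DD (Suc m) (int c) (prepend_max m \<sigma>))
      + (\<Sum>k = 1..m. poly_X ^ DD (Suc m) (int c) (two_block (Suc m) k))"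
    unfolding f_def by (rule sum_avoiders_Suc)
  also have "(\<Sum>\<sigma>\<in>avoiders m. poly_X ^ DD (Suc m) (int c) (prepend_max m \<sigma>)) = f m (Suc c)"
    unfolding f_def by (intro sum.cong refl) (simp only: DD_prepend_max avoiders_iff)
  also have "(\<Sum>k = 1..m. poly_X ^ DD (Suc m) (int c) (two_block (Suc m) k)) = block_sum (Suc m) c"
    unfolding block_sum_def using assms
    by (intro sum.cong) (auto simp: DD_two_block atLeastLessThanSuc_atLeastAtMost)
  finally show ?thesis .
qed

lemma f_large_shift: "n \<le> c \<Longrightarrow> f n c = of_nat ((n choose 2) + 1)"
  unfolding f_def by (simp add: DD_large_shift card_avoiders del: of_nat_Suc)

lemma block_sum_0: "block_sum n 0 = of_nat (n - 1)"
  by (simp add: block_sum_def)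

lemma block_sum_diagonal: "block_sum (n + 2) (n + 1) = of_nat (n + 1) * poly_X"
proof -
  have "block_sum (n + 2) (n + 1) = (\<Sum>k = 1..<n + 2. poly_X)"
    unfolding block_sum_def
  proof (rule sum.cong)
    fix k assume "k \<in> {1..<n + 2}"
    then have "min (min (n + 1) k) (min (n + 2 - (n + 1)) (n + 2 - k)) = 1" by auto
    then show "poly_X ^ min (min (n + 1) k) (min (n + 2 - (n + 1)) (n + 2 - k)) = poly_X" by simp
  qed simp
  then show ?thesis by simp
qed

text \<open>
  All four terms of the minimum grow by one under \<open>(n, c, k) \<mapsto> (n + 2, c + 1, k + 1)\<close>. The summand
  \<open>2 x\<close> comes from the two boundary indices \<open>k = 0\<close> and \<open>k = n\<close>, where the minimum is 0.
\<close>
lemma block_sum_shift: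
  assumes "1 \<le> n" "c \<le> n"
  shows "block_sum (n + 2) (c + 1) = poly_X * block_sum n c + 2 * poly_X"
proof -
  let ?g = "\<lambda>k. min (min c k) (min (n - c) (n - k))"
  have "block_sum (n + 2) (c + 1) =
      (\<Sum>k = Suc 0..<Suc (Suc n). poly_X ^ min (min (c + 1) k) (min (n + 2 - (c + 1)) (n + 2 - k)))"
    by (simp add: block_sum_def)
  also have "\<dots> = (\<Sum>k = 0..<Suc n.
      poly_X ^ min (min (c + 1) (Suc k)) (min (n + 2 - (c + 1)) (n + 2 - Suc k)))"
    by (rule sum.shift_bounds_Suc_ivl)
  also have "\<dots> = (\<Sum>k = 0..<Suc n. poly_X * poly_X ^ ?g k)"
  proof (rule sum.cong)
    fix k assume "k \<in> {0..<Suc n}"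
    then have "min (min (c + 1) (Suc k)) (min (n + 2 - (c + 1)) (n + 2 - Suc k)) = Suc (?g k)"
      using assms by (auto simp: min_def)
    then show "poly_X ^ min (min (c + 1) (Suc k)) (min (n + 2 - (c + 1)) (n + 2 - Suc k)) =
        poly_X * poly_X ^ ?g k" by (simp only: power_Suc)
  qed simp
  also have "\<dots> = poly_X * (\<Sum>k = 0..<Suc n. poly_X ^ ?g k)"
    by (simp only: sum_distrib_left)
  also have "(\<Sum>k = 0..<Suc n. poly_X ^ ?g k) = 1 + block_sum n c + 1"
    using assms by (simp add: block_sum_def sum.atLeast_Suc_lessThan)
  finally show ?thesis by (simp only: distrib_left mult_1_right mult_2 add_ac)
qed

section \<open>The recurrence for shift zero\<close>

definition gap :: "nat \<Rightarrow> nat \<Rightarrow> int poly" where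
  "gap n c = f (n + 2) (c + 1) - poly_X * f n c"

lemma gap_Suc: "c \<le> m \<Longrightarrow> gap (Suc m) c = gap m (Suc c) + 2 * poly_X"
  using f_Suc[of c m] f_Suc[of "c + 1" "m + 2"] block_sum_shift[of "Suc m" c]
  by (simp add: gap_def algebra_simps)

text \<open>
  The bound \<open>c + i \<le> m + 1\<close> says that each of the \<open>i\<close> steps starts from a shift smaller
  than the length.
\<close>
lemma gap_iterate:
  "c + i \<le> Suc m \<Longrightarrow> gap (m + i) c = gap m (c + i) + of_nat i * (2 * poly_X)"
proof (induction i arbitrary: m)
  case 0
  show ?case by simp
next
  case (Suc i)
  have "gap (m + Suc i) c = gap (Suc m + i) c" by simp
  also have "\<dots> = gap (Suc m) (c + i) + of_nat i * (2 * poly_X)"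
    using Suc.prems by (intro Suc.IH) simp
  also have "gap (Suc m) (c + i) = gap m (c + Suc i) + 2 * poly_X"
    using Suc.prems gap_Suc[of "c + i" m] by simp
  finally show ?case by (simp only: of_nat_Suc distrib_right mult_1_left add_ac)
qed

text \<open>
  Descending from \<open>(n, 0)\<close> ends on or just above the diagonal, according to the parity of \<open>n\<close>.
  On the diagonal one further step of the recursion is needed before \<open>f (m + 2) (m + 1)\<close>
  reaches the range of large shifts.
\<close>
lemma gap_diagonal:
  "gap m m = of_nat ((Suc m choose 2) + 1) + of_nat (m + 1) * poly_X
     - poly_X * of_nat ((m choose 2) + 1)"
  using f_Suc[of "m + 1" "m + 1"] block_sum_diagonal[of m]
  by (simp add: gap_def f_large_shift del: of_nat_Suc of_nat_add)

lemma gap_above_diagonal: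
  "gap m (Suc m) = of_nat ((m + 2 choose 2) + 1) - poly_X * of_nat ((m choose 2) + 1)"
  by (simp add: gap_def f_large_shift del: of_nat_Suc of_nat_add)

lemma f_eq_gap: "f (n + 3) 0 = poly_X * f n 0 + gap n 0 + of_nat (n + 2)"
  using f_Suc[of 0 "n + 2"] by (simp add: gap_def block_sum_0 numeral_3_eq_3 del: of_nat_Suc of_nat_add)

lemma of_nat_Suc_choose_2: "of_nat (Suc m choose 2) = (of_nat (m choose 2) + of_nat m :: 'a :: comm_semiring_1)"
  by (simp add: numeral_2_eq_2 add.commute)

lemma f_even:
  "f (2 * m + 3) 0 = poly_X * f (2 * m) 0 +
     (3 * of_nat m + of_nat (m choose 2) + 3 + poly_X * (3 * of_nat m - of_nat (m choose 2)))"
proof -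
  have rearrange: "p = y * a + (3 * M + C + 3 + y * (3 * M - C))"
    if "p = y * a + H + (M + M + 2)"
      "H = (C + M + 1) + (M + 1) * y - y * (C + 1) + M * (2 * y)"
    for p y a C M H :: "int poly"
    unfolding that by (simp add: algebra_simps)
  have "gap (2 * m) 0 = gap m m + of_nat m * (2 * poly_X)"
    using gap_iterate[of 0 m m] by (simp only: mult_2 add_0 le_SucI le_refl)
  then have H: "gap (2 * m) 0 = (of_nat (m choose 2) + of_nat m + 1) + (of_nat m + 1) * poly_X
      - poly_X * (of_nat (m choose 2) + 1) + of_nat m * (2 * poly_X)"
    by (simp only: gap_diagonal of_nat_add of_nat_1 of_nat_Suc_choose_2)
  have "f (2 * m + 3) 0 = poly_X * f (2 * m) 0 + gap (2 * m) 0 + (of_nat m + of_nat m + 2)"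
    using f_eq_gap[of "2 * m"] by (simp only: mult_2 of_nat_add of_nat_numeral)
  from rearrange[OF this H] show ?thesis .
qed

lemma f_odd:
  "f (2 * m + 4) 0 = poly_X * f (2 * m + 1) 0 +
     (4 * of_nat m + of_nat (m choose 2) + 5 + poly_X * (2 * of_nat m + 1 - of_nat (m choose 2)))"
proof -
  have rearrange: "p = y * a + (4 * M + C + 5 + y * (2 * M + 1 - C))"
    if "p = y * a + H + (M + M + 1 + 2)"
      "H = (C + M + (M + 1) + 1) - y * (C + 1) + (M + 1) * (2 * y)"
    for p y a C M H :: "int poly"
    unfolding that by (simp add: algebra_simps)
  have "gap (m + (m + 1)) 0 = gap m (Suc m) + of_nat (m + 1) * (2 * poly_X)"
    using gap_iterate[of 0 "m + 1" m] by (simp only: Suc_eq_plus1 add_0 le_refl)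
  then have H: "gap (2 * m + 1) 0 = (of_nat (m choose 2) + of_nat m + (of_nat m + 1) + 1)
      - poly_X * (of_nat (m choose 2) + 1) + (of_nat m + 1) * (2 * poly_X)"
    by (simp only: gap_above_diagonal add_2_eq_Suc' mult_2 add.assoc[symmetric]
        of_nat_add of_nat_1 of_nat_Suc of_nat_Suc_choose_2 add.commute[of 1])
  have "2 * m + 4 = (2 * m + 1) + 3" by simp
  then have "f (2 * m + 4) 0 =
      poly_X * f (2 * m + 1) 0 + gap (2 * m + 1) 0 + (of_nat m + of_nat m + 1 + 2)"
    using f_eq_gap[of "2 * m + 1"] by (simp only: mult_2 of_nat_add of_nat_numeral of_nat_1)
  from rearrange[OF this H] show ?thesis .
qed

text \<open>
  Substituting the three-step relation for the six terms of highest index leaves the operator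
  \<open>(1 - t) (1 - t^2)^2\<close> applied to the inhomogeneous parts. It cancels them because both parity
  classes of these are quadratic with the same leading coefficient \<open>(1 - y) / 2\<close> in \<open>m\<close>.
\<close>
lemma order_8_recurrence:
  fixes a :: "nat \<Rightarrow> 'a :: comm_ring_1"
  assumes even: "\<And>m. a (2 * m + 3) = y * a (2 * m) +
      (3 * of_nat m + of_nat (m choose 2) + 3 + y * (3 * of_nat m - of_nat (m choose 2)))"
    and odd: "\<And>m. a (2 * m + 4) = y * a (2 * m + 1) +
      (4 * of_nat m + of_nat (m choose 2) + 5 + y * (2 * of_nat m + 1 - of_nat (m choose 2)))"
  shows "a (n + 8) = a (n + 7) + 2 * a (n + 6) + (y - 2) * a (n + 5) - (y + 1) * a (n + 4)
    - (2 * y - 1) * a (n + 3) + 2 * y * a (n + 2) + y * a (n + 1) - y * a n"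
proof -
  have even': "a N = y * a N' +
      (3 * of_nat k + of_nat (k choose 2) + 3 + y * (3 * of_nat k - of_nat (k choose 2)))"
    if "N = 2 * k + 3" "N' = 2 * k" for N N' k
    unfolding that by (rule even)
  have odd': "a N = y * a N' +
      (4 * of_nat k + of_nat (k choose 2) + 5 + y * (2 * of_nat k + 1 - of_nat (k choose 2)))"
    if "N = 2 * k + 4" "N' = 2 * k + 1" for N N' k
    unfolding that by (rule odd)
  show ?thesis
  proof (cases "even n")
    case True
    then obtain m where n: "n = 2 * m" by blast
    let ?M = "of_nat m :: 'a" and ?C = "of_nat (m choose 2) :: 'a"
    have e3: "a (n + 3) = y * a n + (3 * ?M + ?C + 3 + y * (3 * ?M - ?C))"
      using even'[of "n + 3" "m" "n"] by (simp add: n of_nat_Suc_choose_2 algebra_simps)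
    have e4: "a (n + 4) = y * a (n + 1) + (4 * ?M + ?C + 5 + y * (2 * ?M + 1 - ?C))"
      using odd'[of "n + 4" "m" "n + 1"] by (simp add: n of_nat_Suc_choose_2 algebra_simps)
    have e5: "a (n + 5) = y * a (n + 2) + (4 * ?M + ?C + 6 + y * (2 * ?M + 3 - ?C))"
      using even'[of "n + 5" "Suc m" "n + 2"] by (simp add: n of_nat_Suc_choose_2 algebra_simps)
    have e6: "a (n + 6) = y * a (n + 3) + (5 * ?M + ?C + 9 + y * (?M + 3 - ?C))"
      using odd'[of "n + 6" "Suc m" "n + 3"] by (simp add: n of_nat_Suc_choose_2 algebra_simps)
    have e7: "a (n + 7) = y * a (n + 4) + (5 * ?M + ?C + 10 + y * (?M + 5 - ?C))"
      using even'[of "n + 7" "Suc (Suc m)" "n + 4"] by (simp add: n of_nat_Suc_choose_2 algebra_simps)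
    have e8: "a (n + 8) = y * a (n + 5) + (6 * ?M + ?C + 14 + y * (4 - ?C))"
      using odd'[of "n + 8" "Suc (Suc m)" "n + 5"] by (simp add: n of_nat_Suc_choose_2 algebra_simps)
    show ?thesis
      by (simp only: e3 e4 e5 e6 e7 e8) (simp add: algebra_simps)
  next
    case False
    then obtain m where n: "n = 2 * m + 1" using oddE by blast
    let ?M = "of_nat m :: 'a" and ?C = "of_nat (m choose 2) :: 'a"
    have e3: "a (n + 3) = y * a n + (4 * ?M + ?C + 5 + y * (2 * ?M + 1 - ?C))"
      using odd'[of "n + 3" "m" "n"] by (simp add: n of_nat_Suc_choose_2 algebra_simps)
    have e4: "a (n + 4) = y * a (n + 1) + (4 * ?M + ?C + 6 + y * (2 * ?M + 3 - ?C))"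
      using even'[of "n + 4" "Suc m" "n + 1"] by (simp add: n of_nat_Suc_choose_2 algebra_simps)
    have e5: "a (n + 5) = y * a (n + 2) + (5 * ?M + ?C + 9 + y * (?M + 3 - ?C))"
      using odd'[of "n + 5" "Suc m" "n + 2"] by (simp add: n of_nat_Suc_choose_2 algebra_simps)
    have e6: "a (n + 6) = y * a (n + 3) + (5 * ?M + ?C + 10 + y * (?M + 5 - ?C))"
      using even'[of "n + 6" "Suc (Suc m)" "n + 3"] by (simp add: n of_nat_Suc_choose_2 algebra_simps)
    have e7: "a (n + 7) = y * a (n + 4) + (6 * ?M + ?C + 14 + y * (4 - ?C))"
      using odd'[of "n + 7" "Suc (Suc m)" "n + 4"] by (simp add: n of_nat_Suc_choose_2 algebra_simps)
    have e8: "a (n + 8) = y * a (n + 5) + (6 * ?M + ?C + 15 + y * (6 - ?C))"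
      using even'[of "n + 8" "Suc (Suc (Suc m))" "n + 5"] by (simp add: n of_nat_Suc_choose_2 algebra_simps)
    show ?thesis
      by (simp only: e3 e4 e5 e6 e7 e8) (simp add: algebra_simps)
  qed
qed

lemma initial_values:
  fixes a :: "nat \<Rightarrow> 'a :: comm_ring_1"
  assumes even: "\<And>m. a (2 * m + 3) = y * a (2 * m) +
      (3 * of_nat m + of_nat (m choose 2) + 3 + y * (3 * of_nat m - of_nat (m choose 2)))"
    and odd: "\<And>m. a (2 * m + 4) = y * a (2 * m + 1) +
      (4 * of_nat m + of_nat (m choose 2) + 5 + y * (2 * of_nat m + 1 - of_nat (m choose 2)))"
    and a012: "a 0 = 1" "a 1 = 1" "a 2 = 2"
  shows "a 3 = y + 3" "a 4 = 2 * y + 5" "a 5 = 5 * y + 6" "a 6 = y ^ 2 + 6 * y + 9"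
    "a 7 = 2 * y ^ 2 + 10 * y + 10" "a 8 = 5 * y ^ 2 + 10 * y + 14"
proof -
  show a3: "a 3 = y + 3" using even[of 0] a012 by (simp add: binomial_eq_0)
  show a4: "a 4 = 2 * y + 5" using odd[of 0] a012 by (simp add: algebra_simps binomial_eq_0)
  show a5: "a 5 = 5 * y + 6" using even[of 1] a012(3) a012(3)[unfolded numeral_2_eq_2] by (simp add: algebra_simps binomial_eq_0)
  show "a 6 = y ^ 2 + 6 * y + 9"
    using odd[of 1] a3 a3[unfolded numeral_3_eq_3] by (simp add: algebra_simps power2_eq_square binomial_eq_0)
  show "a 7 = 2 * y ^ 2 + 10 * y + 10"
    using even[of 2] a4 by (simp add: algebra_simps power2_eq_square)
  show "a 8 = 5 * y ^ 2 + 10 * y + 14"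
    using odd[of 2] a5 by (simp add: algebra_simps power2_eq_square)
qed

lemma f_012: "f 0 c = 1" "f 1 c = 1" "f 2 0 = 2"
proof -
  show 0: "f 0 c = 1" for c using f_large_shift[of 0 c] by simp
  have "f 1 0 = 1" using f_Suc[of 0 0] 0 by (simp add: block_sum_0)
  then show 1: "f 1 c = 1" for c
    using f_large_shift[of 1 c] by (cases c) simp_all
  show "f 2 0 = 2" using f_Suc[of 0 1] 1 by (simp add: block_sum_0 numeral_2_eq_2)
qed

lemma f_recursion:
  assumes "1 \<le> n" "c < n"
  shows "f n c = f (n - 1) (c + 1) + (\<Sum>i = 2..n. poly_X ^ Min {c, i - 1, n - c, n - i + 1})"
proof -
  have "(\<Sum>i = 2..n. poly_X ^ Min {c, i - 1, n - c, n - i + 1}) = block_sum n c"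
    unfolding block_sum_def
    by (rule sum.reindex_bij_witness[of _ Suc "\<lambda>i. i - 1"])
      (auto simp: min.assoc Suc_diff_le)
  then show ?thesis
    using assms f_Suc[of c "n - 1"] by simp
qed

lemma poly_f_1: "poly (f n c) 1 = int ((n choose 2) + 1)"
  unfolding f_def by (simp add: poly_sum card_avoiders)

theorem mainTheorem13:
  fixes S :: "nat list set"
  assumes "S = {[1, 2, 3], [2, 3, 1]}"
  shows
    "(\<forall>n c :: nat. 1 \<le> n \<longrightarrow> c < n \<longrightarrow>
        f_poly S n c = f_poly S (n - 1) (c + 1)
          + (\<Sum>i = 2..n. poly_X ^ Min {c, i - 1, n - c, n - i + 1}))
     \<and> (\<forall>c :: nat. f_poly S 0 c = 1 \<and> f_poly S 1 c = 1)
     \<and> (\<forall>n c :: nat. n \<le> c \<longrightarrow> f_poly S n c = of_nat ((n choose 2) + 1))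
     \<and> (\<forall>n c :: nat. poly (f_poly S n c) 1 = int ((n choose 2) + 1))
     \<and> (\<forall>n :: nat.
        f_poly S (n + 8) 0 =
            f_poly S (n + 7) 0
          + 2 * f_poly S (n + 6) 0
          + (poly_X - 2) * f_poly S (n + 5) 0
          - (poly_X + 1) * f_poly S (n + 4) 0
          - (2 * poly_X - 1) * f_poly S (n + 3) 0
          + 2 * poly_X * f_poly S (n + 2) 0
          + poly_X * f_poly S (n + 1) 0
          - poly_X * f_poly S n 0)
     \<and> f_poly S 0 0 = 1
     \<and> f_poly S 1 0 = 1
     \<and> f_poly S 2 0 = 2
     \<and> f_poly S 3 0 = poly_X + 3
     \<and> f_poly S 4 0 = 2 * poly_X + 5
     \<and> f_poly S 5 0 = 5 * poly_X + 6
     \<and> f_poly S 6 0 = poly_X ^ 2 + 6 * poly_X + 9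
     \<and> f_poly S 7 0 = 2 * poly_X ^ 2 + 10 * poly_X + 10
     \<and> f_poly S 8 0 = 5 * poly_X ^ 2 + 10 * poly_X + 14"
proof -
  have "f_poly S = f"
    by (intro ext) (simp only: f_poly_def f_def avoiders_def assms)
  then show ?thesis
    by (simp only:) (intro conjI allI impI f_recursion f_012 f_large_shift poly_f_1
        order_8_recurrence initial_values f_even f_odd)
qed

end
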